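(* Let $b\in\mathbb{R}$ and consider the system $\dot x=x+yz,\ \dot y=by+xz,\ \dot z=z-xy$ on $\mathbb{R}^3$. Then: (i) For $b>0$ there exists a unique fixed point, located at the origin, and this fixed point is globally repelling. (ii) For $b=0$ the whole $y$-axis consists of fixed points, and all other orbits tend to one of these fixed points for $t\to-\infty$ and to infinity for $t\to+\infty$. (iii) For $b<0$ there exists a unique fixed point, located at the origin; this fixed point is hyperbolic and has a one-dimensional stable manifold, namely the $y$-axis; all other orbits (that is, those not contained in the $y$-axis) tend to infinity for $t\to+\infty$.
   Context: A fixed point is globally repelling if it is globally attracting for the time-reversed flow, i.e. every orbit tends to it as $t\to-\infty$. An orbit tends to infinity if its Euclidean norm tends to $+\infty$. *)

theory Defs
  imports "HOL-Analysis.Analysis"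
begin

section \<open>Autonomous differential equations\<close>

definition solution_on :: "('a::real_normed_vector \<Rightarrow> 'a) \<Rightarrow> real set \<Rightarrow> (real \<Rightarrow> 'a) \<Rightarrow> bool" where
  "solution_on f T \<phi> \<longleftrightarrow> open T \<and> is_interval T \<and> T \<noteq> {} \<and>
     (\<forall>t\<in>T. (\<phi> has_vector_derivative f (\<phi> t)) (at t))"

text \<open>
  An orbit is a maximal solution, given by its open interval of existence \<open>T\<close> and a function
  whose values outside \<open>T\<close> are irrelevant. The set traced out is \<open>\<phi> ` T\<close>. Completeness of the
  flow is not presupposed: the limit notions below require that the orbit exists
  for all sufficiently large (or sufficiently negative) times.
\<close>

definition orbit :: "('a::real_normed_vector \<Rightarrow> 'a) \<Rightarrow> real set \<Rightarrow> (real \<Rightarrow> 'a) \<Rightarrow> bool" where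
  "orbit f T \<phi> \<longleftrightarrow> solution_on f T \<phi> \<and>
     (\<forall>S \<psi>. solution_on f S \<psi> \<and> T \<subseteq> S \<and> (\<forall>t\<in>T. \<psi> t = \<phi> t) \<longrightarrow> S = T)"

definition tends_forward :: "real set \<Rightarrow> (real \<Rightarrow> 'a::real_normed_vector) \<Rightarrow> 'a \<Rightarrow> bool" where
  "tends_forward T \<phi> p \<longleftrightarrow> (\<forall>\<^sub>F t in at_top. t \<in> T) \<and> (\<phi> \<longlongrightarrow> p) at_top"

definition tends_backward :: "real set \<Rightarrow> (real \<Rightarrow> 'a::real_normed_vector) \<Rightarrow> 'a \<Rightarrow> bool" where
  "tends_backward T \<phi> p \<longleftrightarrow> (\<forall>\<^sub>F t in at_bot. t \<in> T) \<and> (\<phi> \<longlongrightarrow> p) at_bot"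

definition escapes_forward :: "real set \<Rightarrow> (real \<Rightarrow> 'a::real_normed_vector) \<Rightarrow> bool" where
  "escapes_forward T \<phi> \<longleftrightarrow>
     (\<forall>\<^sub>F t in at_top. t \<in> T) \<and> filterlim (\<lambda>t. norm (\<phi> t)) at_top at_top"

definition fixed_point :: "('a::real_normed_vector \<Rightarrow> 'a) \<Rightarrow> 'a \<Rightarrow> bool" where
  "fixed_point f p \<longleftrightarrow> f p = 0"

definition globally_repelling :: "('a::real_normed_vector \<Rightarrow> 'a) \<Rightarrow> 'a \<Rightarrow> bool" where
  "globally_repelling f p \<longleftrightarrow> (\<forall>T \<phi>. orbit f T \<phi> \<longrightarrow> tends_backward T \<phi> p)"

definition eigenvalue :: "complex^'n^'n \<Rightarrow> complex \<Rightarrow> bool" where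
  "eigenvalue A \<mu> \<longleftrightarrow> (\<exists>v. v \<noteq> 0 \<and> A *v v = \<mu> *s v)"

definition hyperbolic :: "(real^'n \<Rightarrow> real^'n) \<Rightarrow> real^'n \<Rightarrow> bool" where
  "hyperbolic f p \<longleftrightarrow> fixed_point f p \<and> f differentiable (at p) \<and>
     (\<forall>\<mu>. eigenvalue (map_matrix complex_of_real (jacobian f (at p))) \<mu> \<longrightarrow> Re \<mu> \<noteq> 0)"

definition stable_manifold :: "('a::real_normed_vector \<Rightarrow> 'a) \<Rightarrow> 'a \<Rightarrow> 'a set" where
  "stable_manifold f p = {q. \<exists>T \<phi>. orbit f T \<phi> \<and> 0 \<in> T \<and> \<phi> 0 = q \<and> tends_forward T \<phi> p}"

section \<open>The system\<close>

definition vf :: "real \<Rightarrow> real^3 \<Rightarrow> real^3" where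
  "vf b p = (let x = p $ 1; y = p $ 2; z = p $ 3
             in vector [x + y * z, b * y + x * z, z - x * y])"

definition y_axis :: "(real^3) set" where
  "y_axis = {p. p $ 1 = 0 \<and> p $ 3 = 0}"

end

(* Along solutions r^2 = x^2 + z^2 satisfies (r^2)' = 2 r^2, so r^2 grows exactly like exp (2t), and
   y' = b y + x z with |x z| <= r^2 / 2. Hence y stays bounded on bounded time intervals and all
   orbits are complete. Off the y-axis r tends to infinity as t -> +oo and to 0 as t -> -oo.
   For b > 0 the function y^2 + k r^2 decays exponentially as t -> -oo for suitable k; for b = 0 the
   bound |y'| <= C exp (2t) makes y converge as t -> -oo; for b < 0 the y-axis contracts to the origin. *)

theory Submission
  imports Defs "HOL-Real_Asymp.Real_Asymp"
begin

section \<open>Local existence and continuation of solutions\<close>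

text \<open>An orbit comes with an unknown interval of existence, and each limit notion demands
  existence for all sufficiently large (or sufficiently negative) times, so completeness has to
  precede every asymptotic claim. The field is quadratic, hence only locally Lipschitz, and
  finite-time blow-up must be excluded by an a priori bound. The source of that bound is the
  cancellation \<open>x (y z) + z (- x y) = 0\<close>, which keeps the nonlinearity out of the
  radial equation; once r is known, the equation for y is linear with known forcing. Continuation
  converts boundedness on finite windows into completeness: a solution bounded up to a finite end of
  its interval could be prolonged by a Picard solution, against maximality. The past is the future
  of the time-reversed field.\<close>

text \<open>Picard iteration for \<open>f\<close> precomposed with the projection onto the ball. The
  projection is nonexpansive, so the modified field is bounded and globally Lipschitz; for a short
  time its solution stays in the ball, where both fields agree.\<close>

lemma local_existence:
  fixes f :: "'a::euclidean_space \<Rightarrow> 'a"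
  assumes r: "r > 0" and lip: "L-lipschitz_on (cball p r) f"
  obtains d \<psi> where "d > 0" "\<psi> a = p" "continuous_on {a..a+d} \<psi>"
    "\<And>t. t \<in> {a<..<a+d} \<Longrightarrow> (\<psi> has_vector_derivative f (\<psi> t)) (at t)"
proof -
  define g where "g = (\<lambda>x. f (closest_point (cball p r) x))"
  have cp: "closest_point (cball p r) x \<in> cball p r" for x
    using r by (intro closest_point_in_set) auto
  have L0: "L \<ge> 0"
    using lip by (rule lipschitz_on_nonneg)
  have g_lip: "dist (g x) (g y) \<le> L * dist x y" for x y
  proof -
    have "dist (g x) (g y) \<le> L * dist (closest_point (cball p r) x) (closest_point (cball p r) y)"
      unfolding g_def by (rule lipschitz_onD[OF lip cp cp])
    also have "\<dots> \<le> L * dist x y"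
      using r L0 by (intro mult_left_mono closest_point_lipschitz) auto
    finally show ?thesis .
  qed
  have g_cont: "continuous_on UNIV g"
    using lipschitz_on_continuous_on[OF lipschitz_onI[OF g_lip L0]] .
  define M where "M = norm (f p) + L * r"
  have M0: "M \<ge> 0"
    using L0 r by (simp add: M_def)
  have g_bound: "norm (g x) \<le> M" for x
  proof -
    have "dist (g x) (f p) \<le> L * dist (closest_point (cball p r) x) p"
      unfolding g_def using r by (intro lipschitz_onD[OF lip cp]) auto
    also have "\<dots> \<le> L * r"
      using cp[of x] L0 by (intro mult_left_mono) (auto simp: dist_commute)
    finally show ?thesis
      using norm_triangle_sub[of "g x" "f p"] by (simp add: M_def dist_norm)
  qed
  \<comment> \<open>The first bound keeps the curve within distance \<open>r\<close> of
    \<open>p\<close>, the second makes the Picard operator a contraction. Adding 1 guards against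
    \<open>M = 0\<close> and \<open>L = 0\<close>.\<close>
  define d where "d = min (r / (M + 1)) (1 / (2 * (L + 1)))"
  have d0: "d > 0"
    using r M0 L0 by (simp add: d_def)
  have dM: "M * d \<le> r"
  proof -
    have "M * d \<le> (M + 1) * (r / (M + 1))"
      using M0 d0 by (intro mult_mono) (auto simp: d_def)
    then show ?thesis using M0 by simp
  qed
  have dL: "L * d < 1"
  proof -
    have "L * d \<le> L * (1 / (2 * (L + 1)))"
      using L0 by (intro mult_left_mono) (auto simp: d_def)
    also have "\<dots> < 1"
      using L0 by (simp add: field_simps)
    finally show ?thesis .
  qed
  define c where "c t = max a (min (a + d) t)" for t
  have c_range: "c t \<in> {a..a+d}" for t
    using d0 by (auto simp: c_def)
  have c_id: "c t = t" if "t \<in> {a..a+d}" for t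
    using that by (auto simp: c_def)
  \<comment> \<open>The clamp \<open>c\<close> turns the Picard operator \<open>F\<close> into a contraction \<open>K\<close> of the complete
    space of bounded continuous functions on all of \<open>\<real>\<close>.\<close>
  define F where "F \<phi> t = p + integral {a..t} (\<lambda>s. g (apply_bcontfun \<phi> s))"
    for \<phi> :: "real \<Rightarrow>\<^sub>C 'a" and t
  have comp_cont: "continuous_on S (\<lambda>s. g (apply_bcontfun \<phi> s))" for \<phi> :: "real \<Rightarrow>\<^sub>C 'a" and S
    by (rule continuous_on_compose2[OF g_cont]) auto
  have F_cont: "continuous_on {a..a+d} (F \<phi>)" for \<phi>
    unfolding F_def
    by (intro continuous_intros indefinite_integral_continuous_1 integrable_continuous_real comp_cont)
  have F_near: "norm (F \<phi> t - p) \<le> r" if "t \<in> {a..a+d}" for \<phi> t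
  proof -
    have "norm (F \<phi> t - p) \<le> M * (t - a)"
      unfolding F_def using that g_bound by (simp add: integral_bound comp_cont)
    also have "\<dots> \<le> M * d"
      using that M0 by (intro mult_left_mono) auto
    finally show ?thesis using dM by simp
  qed
  have "(\<lambda>t. F \<phi> (c t)) \<in> bcontfun" for \<phi>
  proof -
    have "continuous_on UNIV (\<lambda>t. F \<phi> (c t))"
      by (rule continuous_on_compose2[OF F_cont])
         (use c_range in \<open>auto simp: c_def intro!: continuous_intros\<close>)
    moreover have "range (\<lambda>t. F \<phi> (c t)) \<subseteq> cball p r"
      using F_near[OF c_range] by (auto simp: dist_norm norm_minus_commute)
    ultimately show ?thesis
      by (auto simp: bcontfun_def intro: bounded_subset[OF bounded_cball])
  qed
  note Kmem = this
  define K where "K \<phi> = Bcontfun (\<lambda>t. F \<phi> (c t))" for \<phi>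
  have K: "apply_bcontfun (K \<phi>) t = F \<phi> (c t)" for \<phi> t
    by (simp add: K_def Bcontfun_inverse Kmem)
  have "dist (K \<phi>) (K \<eta>) \<le> (L * d) * dist \<phi> \<eta>" for \<phi> \<eta>
  proof (rule dist_bound)
    fix t
    let ?I = "{a..c t}"
    have "dist (K \<phi> t) (K \<eta> t) = norm (integral ?I (\<lambda>s. g (\<phi> s) - g (\<eta> s)))"
      unfolding K F_def dist_norm
      by (subst integral_diff) (auto intro!: integrable_continuous_real comp_cont)
    also have "\<dots> \<le> (L * dist \<phi> \<eta>) * (c t - a)"
    proof (rule integral_bound)
      show "norm (g (\<phi> s) - g (\<eta> s)) \<le> L * dist \<phi> \<eta>" for s
        using order_trans[OF g_lip mult_left_mono[OF dist_bounded L0]] by (simp add: dist_norm)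
    qed (use c_range[of t] in \<open>auto intro!: continuous_intros comp_cont\<close>)
    also have "\<dots> \<le> (L * dist \<phi> \<eta>) * d"
      using c_range[of t] L0 by (intro mult_left_mono) auto
    finally show "dist (K \<phi> t) (K \<eta> t) \<le> (L * d) * dist \<phi> \<eta>"
      by (simp add: mult_ac)
  qed
  then obtain \<phi> where fix_pt: "K \<phi> = \<phi>"
    using banach_fix_type[of "L * d" K] L0 d0 dL by auto
  have eq: "\<phi> t = F \<phi> t" if "t \<in> {a..a+d}" for t
    using K[of \<phi> t] that by (simp add: fix_pt c_id)
  show thesis
  proof
    show "d > 0" by fact
    show "\<phi> a = p"
      using eq[of a] d0 by (simp add: F_def)
    show "continuous_on {a..a+d} \<phi>" by simp
    fix t assume t: "t \<in> {a<..<a+d}"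
    have "((\<lambda>u. integral {a..u} (\<lambda>s. g (\<phi> s))) has_vector_derivative g (\<phi> t)) (at t within {a..a+d})"
      by (rule integral_has_vector_derivative) (use t comp_cont in auto)
    then have "(F \<phi> has_vector_derivative g (\<phi> t)) (at t within {a..a+d})"
      unfolding F_def by (auto intro!: derivative_eq_intros)
    then have "(F \<phi> has_vector_derivative g (\<phi> t)) (at t)"
      using at_within_interior[of t "{a..a+d}"] t by (simp add: interior_atLeastAtMost_real)
    then have "(\<phi> has_vector_derivative g (\<phi> t)) (at t)"
      by (rule has_vector_derivative_transform_within_open[of _ _ _ "{a<..<a+d}"])
         (use t in \<open>auto simp: eq\<close>)
    moreover have "g (\<phi> t) = f (\<phi> t)"
      using F_near[of t \<phi>] eq[of t] t
      by (simp add: g_def closest_point_self dist_norm norm_minus_commute)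
    ultimately show "(\<phi> has_vector_derivative f (\<phi> t)) (at t)"
      by simp
  qed
qed

text \<open>The fundamental theorem of calculus tolerates one exceptional point, so the function is
  an integral of the continuous \<open>g\<close>, and such an integral is differentiable at that
  point as well. It serves for the seam of two glued solutions.\<close>

lemma removable_vector_derivative:
  fixes \<phi> g :: "real \<Rightarrow> 'a::banach"
  assumes "continuous_on {u..v} \<phi>" "continuous_on {u..v} g" "a \<in> {u<..<v}"
    and deriv: "\<And>t. t \<in> {u<..<v} - {a} \<Longrightarrow> (\<phi> has_vector_derivative g t) (at t)"
  shows "(\<phi> has_vector_derivative g a) (at a)"
proof -
  have eq: "\<phi> t = \<phi> u + integral {u..t} g" if "t \<in> {u<..<v}" for t
  proof -
    have "(g has_integral (\<phi> t - \<phi> u)) {u..t}"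
      by (rule fundamental_theorem_of_calculus_interior_strong[of "{a}"])
         (use that deriv in \<open>auto intro: continuous_on_subset[OF assms(1)]\<close>)
    then show ?thesis by (simp add: integral_unique)
  qed
  have "((\<lambda>t. integral {u..t} g) has_vector_derivative g a) (at a within {u..v})"
    using assms by (intro integral_has_vector_derivative) auto
  then have "((\<lambda>t. \<phi> u + integral {u..t} g) has_vector_derivative g a) (at a)"
    using at_within_interior[of a "{u..v}"] assms(3)
    by (auto simp: interior_atLeastAtMost_real intro!: derivative_eq_intros)
  then show ?thesis
    by (rule has_vector_derivative_transform_within_open[of _ _ _ "{u<..<v}"])
       (use assms(3) eq in auto)
qed

lemma orbit_contains_future:
  fixes f :: "'a::euclidean_space \<Rightarrow> 'a"
  assumes lip: "\<And>p. \<exists>r>0. \<exists>L. L-lipschitz_on (cball p r) f"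
    and orb: "orbit f T \<phi>" and t0: "t0 \<in> T"
    and bdd: "\<And>a. bounded (\<phi> ` (T \<inter> {t0..a}))"
  shows "{t0..} \<subseteq> T"
proof (rule ccontr)
  assume "\<not> {t0..} \<subseteq> T"
  then obtain s where s: "s \<ge> t0" "s \<notin> T" by auto
  have T: "open T" "is_interval T" "T \<noteq> {}"
    and sol: "\<And>t. t \<in> T \<Longrightarrow> (\<phi> has_vector_derivative f (\<phi> t)) (at t)"
    using orb by (auto simp: orbit_def solution_on_def)
  have "t \<le> s" if "t \<in> T" for t
    using s t0 T(2) that unfolding is_interval_1 by (meson linear)
  then have up: "bdd_above T" by (rule bdd_aboveI)
  define a where "a = Sup T"
  have below: "t < a" if t: "t \<in> T" for t
  proof -
    obtain e where "e > 0" "ball t e \<subseteq> T"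
      using T(1) t openE by blast
    then have "t + e / 2 \<in> T"
      by (auto simp: dist_real_def subset_iff)
    then have "t + e / 2 \<le> a"
      unfolding a_def using up by (rule cSup_upper)
    then show ?thesis using \<open>e > 0\<close> by simp
  qed
  have inT: "t \<in> T" if t: "t \<in> {t0..<a}" for t
  proof -
    obtain t' where "t' \<in> T" "t < t'"
      using t less_cSupD[OF T(3), of t] unfolding a_def by auto
    then show ?thesis
      using T(2) t0 t unfolding is_interval_1 by (meson atLeastLessThan_iff less_imp_le)
  qed
  have f_cont: "continuous_on UNIV f"
  proof -
    have "isCont f p" for p
    proof -
      obtain r L where "r > 0" "L-lipschitz_on (cball p r) f" using lip by blast
      then have "continuous_on (ball p r) f"
        by (meson ball_subset_cball continuous_on_subset lipschitz_on_continuous_on)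
      then show ?thesis
        using \<open>r > 0\<close> by (simp add: continuous_on_eq_continuous_at)
    qed
    then show ?thesis by (simp add: continuous_at_imp_continuous_on)
  qed
  \<comment> \<open>The closure of a bounded set is compact here, so the speed along the orbit is
    bounded. The orbit is then Lipschitz up to \<open>a\<close> and has a limit there, from which a
    new solution can start.\<close>
  have "bounded (f ` (closure (\<phi> ` (T \<inter> {t0..a}))))"
    using bdd[of a] f_cont
    by (intro compact_imp_bounded compact_continuous_image)
       (auto intro: continuous_on_subset)
  then have "bounded (f ` \<phi> ` (T \<inter> {t0..a}))"
    by (rule bounded_subset) (intro image_mono closure_subset)
  then have "\<exists>M. \<forall>t\<in>T \<inter> {t0..a}. norm (f (\<phi> t)) \<le> M"
    by (simp only: bounded_iff ball_simps)
  then obtain M where M: "\<And>t. t \<in> T \<inter> {t0..a} \<Longrightarrow> norm (f (\<phi> t)) \<le> M"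
    by blast
  have M0: "0 \<le> M"
    using order_trans[OF norm_ge_zero M[of t0]] t0 below[OF t0] by simp
  have "M-lipschitz_on {t0..<a} \<phi>"
  proof (rule bounded_derivative_imp_lipschitz)
    fix t assume t: "t \<in> {t0..<a}"
    show "(\<phi> has_derivative (\<lambda>h. h *\<^sub>R f (\<phi> t))) (at t within {t0..<a})"
      using sol[OF inT[OF t]] by (auto simp: has_vector_derivative_def intro: has_derivative_at_withinI)
    show "onorm (\<lambda>h. h *\<^sub>R f (\<phi> t)) \<le> M"
      using M[of t] inT[OF t] t
      by (intro onorm_le) (auto simp: mult.commute[of M] intro!: mult_left_mono)
  qed (use M0 in auto)
  then obtain g where g: "uniformly_continuous_on (closure {t0..<a}) g"
    "\<And>t. t \<in> {t0..<a} \<Longrightarrow> \<phi> t = g t"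
    using uniformly_continuous_on_extension_on_closure lipschitz_on_uniformly_continuous by metis
  have g_cont: "continuous_on {t0..a} g"
    using uniformly_continuous_imp_continuous[OF g(1)] below[OF t0] by simp
  obtain r L where r: "r > 0" "L-lipschitz_on (cball (g a) r) f"
    using lip by blast
  obtain d \<psi> where d: "d > 0" and \<psi>a: "\<psi> a = g a" and \<psi>_cont: "continuous_on {a..a+d} \<psi>"
    and \<psi>': "\<And>t. t \<in> {a<..<a+d} \<Longrightarrow> (\<psi> has_vector_derivative f (\<psi> t)) (at t)"
    using local_existence[OF r] by metis
  define \<Phi> where "\<Phi> t = (if t < a then \<phi> t else \<psi> t)" for t
  \<comment> \<open>Starting the added interval at \<open>t0\<close> makes it overlap
    \<open>T\<close>, so the union is connected; it contains \<open>a\<close>, which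
    \<open>T\<close> lacks.\<close>
  define S where "S = T \<union> {t0<..<a+d}"
  have \<Phi>_cont: "continuous_on {t0..a+d} \<Phi>"
  proof -
    have "continuous_on ({t0..a} \<union> {a..a+d}) (\<lambda>t. if t \<le> a then g t else \<psi> t)"
      using g_cont \<psi>_cont \<psi>a by (intro continuous_on_If) auto
    moreover have "{t0..a} \<union> {a..a+d} = {t0..a+d}"
      using below[OF t0] d by auto
    ultimately have "continuous_on {t0..a+d} (\<lambda>t. if t \<le> a then g t else \<psi> t)"
      by simp
    then show ?thesis
      by (rule continuous_on_eq) (auto simp: \<Phi>_def g(2) \<psi>a)
  qed
  have left: "(\<Phi> has_vector_derivative f (\<Phi> t)) (at t)" if "t \<in> T" for t
    by (rule has_vector_derivative_transform_within_open[of \<phi> _ _ "{..<a}"])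
       (use sol[OF that] below[OF that] in \<open>auto simp: \<Phi>_def\<close>)
  have right: "(\<Phi> has_vector_derivative f (\<Phi> t)) (at t)" if "t \<in> {a<..<a+d}" for t
    by (rule has_vector_derivative_transform_within_open[of \<psi> _ _ "{a<..}"])
       (use \<psi>'[OF that] that in \<open>auto simp: \<Phi>_def\<close>)
  have mid: "(\<Phi> has_vector_derivative f (\<Phi> a)) (at a)"
  proof (rule removable_vector_derivative[of t0 "a + d"])
    show "continuous_on {t0..a + d} (\<lambda>t. f (\<Phi> t))"
      by (rule continuous_on_compose2[OF f_cont \<Phi>_cont]) auto
    fix t assume "t \<in> {t0<..<a + d} - {a}"
    then show "(\<Phi> has_vector_derivative f (\<Phi> t)) (at t)"
      using left[OF inT] right by (cases "t < a") auto
  qed (use \<Phi>_cont below[OF t0] d in auto)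
  have "solution_on f S \<Phi>"
    unfolding solution_on_def
  proof (intro conjI ballI)
    show "open S" "S \<noteq> {}"
      using T by (auto simp: S_def)
    have "(t0 + a) / 2 \<in> T \<inter> {t0<..<a+d}"
      using inT below[OF t0] d by auto
    then have "connected S"
      unfolding S_def using T(2) by (intro connected_Un) (auto simp: is_interval_connected_1)
    then show "is_interval S" by (simp add: is_interval_connected_1)
    fix t assume "t \<in> S"
    then consider "t \<in> T" | "t = a" | "t \<in> {a<..<a+d}"
      using inT by (fastforce simp: S_def)
    then show "(\<Phi> has_vector_derivative f (\<Phi> t)) (at t)"
      using left mid right by cases auto
  qed
  moreover have "T \<subseteq> S" "\<forall>t\<in>T. \<Phi> t = \<phi> t"
    using below by (auto simp: S_def \<Phi>_def)
  ultimately have "S = T"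
    using orb by (auto simp: orbit_def)
  moreover have "a \<in> S"
    using below[OF t0] d by (simp add: S_def)
  ultimately show False using below by blast
qed

section \<open>Time reversal and completeness of bounded orbits\<close>

lemma solution_on_reverse:
  assumes "solution_on f T \<phi>"
  shows "solution_on (\<lambda>x. - f x) (uminus ` T) (\<lambda>t. \<phi> (- t))"
  unfolding solution_on_def
proof (intro conjI ballI)
  show "open (uminus ` T)" "is_interval (uminus ` T)" "uminus ` T \<noteq> {}"
    using assms by (auto simp: solution_on_def open_negations)
  fix t assume "t \<in> uminus ` T"
  then have "(\<phi> has_vector_derivative f (\<phi> (- t))) (at (- t))"
    using assms by (auto simp: solution_on_def)
  then have "(\<phi> \<circ> uminus has_vector_derivative (-1) *\<^sub>R f (\<phi> (- t))) (at t)"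
    by (intro vector_diff_chain_at) (auto intro!: derivative_eq_intros)
  then show "((\<lambda>t. \<phi> (- t)) has_vector_derivative - f (\<phi> (- t))) (at t)"
    by (simp add: o_def)
qed

text \<open>Reversal is an involution, so an extension of the reversed solution reverses back to an
  extension of the original one, and maximality carries over.\<close>

lemma orbit_reverse:
  assumes "orbit f T \<phi>"
  shows "orbit (\<lambda>x. - f x) (uminus ` T) (\<lambda>t. \<phi> (- t))"
  unfolding orbit_def
proof (intro conjI allI impI)
  show "solution_on (\<lambda>x. - f x) (uminus ` T) (\<lambda>t. \<phi> (- t))"
    using assms by (intro solution_on_reverse) (auto simp: orbit_def)
  fix S \<psi>
  assume *: "solution_on (\<lambda>x. - f x) S \<psi> \<and> uminus ` T \<subseteq> S \<and> (\<forall>t\<in>uminus ` T. \<psi> t = \<phi> (- t))"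
  then have "solution_on f (uminus ` S) (\<lambda>t. \<psi> (- t))"
    using solution_on_reverse by fastforce
  moreover have "T \<subseteq> uminus ` S" "\<forall>t\<in>T. \<psi> (- t) = \<phi> t"
    using * by force+
  ultimately have "uminus ` S = T"
    using assms by (auto simp: orbit_def)
  then show "S = uminus ` T"
    by (auto simp: image_image)
qed

lemma complete_orbit:
  fixes f :: "'a::euclidean_space \<Rightarrow> 'a"
  assumes lip: "\<And>p. \<exists>r>0. \<exists>L. L-lipschitz_on (cball p r) f"
    and orb: "orbit f T \<phi>"
    and bdd: "\<And>a c. bounded (\<phi> ` (T \<inter> {a..c}))"
  shows "T = UNIV"
proof -
  obtain t0 where t0: "t0 \<in> T"
    using orb by (auto simp: orbit_def solution_on_def)
  have "{t0..} \<subseteq> T"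
    by (rule orbit_contains_future[OF lip orb t0 bdd])
  moreover have "{- t0..} \<subseteq> uminus ` T"
  proof (rule orbit_contains_future[OF _ orbit_reverse[OF orb]])
    show "\<exists>r>0. \<exists>L. L-lipschitz_on (cball p r) (\<lambda>x. - f x)" for p
      using lip[of p] by (auto simp: lipschitz_on_def)
    have "(\<lambda>t. \<phi> (- t)) ` (uminus ` T \<inter> {- t0..a}) \<subseteq> \<phi> ` (T \<inter> {- a..t0})" for a
      by auto
    then show "bounded ((\<lambda>t. \<phi> (- t)) ` (uminus ` T \<inter> {- t0..a}))" for a
      by (rule bounded_subset[OF bdd])
  qed (use t0 in auto)
  ultimately have "t \<in> T" for t
    using atLeast_iff[of t t0] atLeast_iff[of "- t" "- t0"]
    by (metis imageE linear neg_le_iff_le neg_equal_iff_equal subsetD)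
  then show ?thesis by blast
qed

section \<open>Comparison estimates\<close>

text \<open>Gronwall's inequality by the integrating factor \<open>exp (- K * u)\<close>. No sign is
  imposed on \<open>K\<close> or \<open>W\<close>, so it also applies to \<open>- W\<close>.\<close>

lemma exp_growth_bound:
  fixes W W' :: "real \<Rightarrow> real"
  assumes "s \<le> t"
    and deriv: "\<And>u. u \<in> {s..t} \<Longrightarrow> (W has_real_derivative W' u) (at u)"
    and le: "\<And>u. u \<in> {s..t} \<Longrightarrow> W' u \<le> K * W u"
  shows "W t \<le> W s * exp (K * (t - s))"
proof -
  have "W t * exp (- K * t) \<le> W s * exp (- K * s)"
  proof (rule DERIV_nonpos_imp_nonincreasing[OF \<open>s \<le> t\<close>])
    fix u assume u: "s \<le> u" "u \<le> t"
    have "((\<lambda>u. W u * exp (- K * u)) has_real_derivative (W' u - K * W u) * exp (- K * u)) (at u)"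
      using u by (auto intro!: derivative_eq_intros deriv simp: algebra_simps)
    then show "\<exists>y. ((\<lambda>u. W u * exp (- K * u)) has_real_derivative y) (at u) \<and> y \<le> 0"
      using le[of u] u by (auto intro!: exI mult_nonpos_nonneg)
  qed
  then have "W t * exp (- K * t) * exp (K * t) \<le> W s * exp (- K * s) * exp (K * t)"
    by (intro mult_right_mono) auto
  then show ?thesis
    by (simp add: mult.assoc flip: exp_add) (simp add: algebra_simps)
qed

text \<open>The previous bound for \<open>- W\<close>. It estimates an earlier value by a later one
  and is thus the form suited to backward time.\<close>

lemma exp_decay_bound:
  fixes W W' :: "real \<Rightarrow> real"
  assumes "s \<le> t"
    and deriv: "\<And>u. u \<in> {s..t} \<Longrightarrow> (W has_real_derivative W' u) (at u)"
    and ge: "\<And>u. u \<in> {s..t} \<Longrightarrow> K * W u \<le> W' u"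
  shows "W s \<le> W t * exp (- K * (t - s))"
proof -
  have "- W t \<le> - W s * exp (K * (t - s))"
    using exp_growth_bound[of s t "\<lambda>u. - W u" "\<lambda>u. - W' u" K] assms
    by (auto intro!: derivative_eq_intros)
  then have "W s * exp (K * (t - s)) * exp (- K * (t - s)) \<le> W t * exp (- K * (t - s))"
    by (intro mult_right_mono) auto
  then show ?thesis
    by (simp add: mult.assoc flip: exp_add)
qed

lemma mono_bdd_below_tendsto_at_bot:
  fixes u :: "real \<Rightarrow> real"
  assumes mono: "mono u" and bd: "\<And>t. t \<le> 0 \<Longrightarrow> c \<le> u t"
  shows "(u \<longlongrightarrow> Inf (range u)) at_bot"
proof (rule order_tendstoI)
  have "c \<le> u t" for t
    using bd[of "min t 0"] monoD[OF mono, of "min t 0" t] by auto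
  then have bdd: "bdd_below (range u)" by (auto intro!: bdd_belowI[of _ c])
  show "\<forall>\<^sub>F t in at_bot. a < u t" if "a < Inf (range u)" for a
    using that cInf_lower[OF _ bdd] by (intro always_eventually) (auto intro: less_le_trans)
  show "\<forall>\<^sub>F t in at_bot. u t < a" if "Inf (range u) < a" for a
  proof -
    obtain s where "u s < a"
      using \<open>Inf (range u) < a\<close> cInf_less_iff[OF _ bdd] by auto
    then show ?thesis
      by (intro eventually_mono[OF eventually_le_at_bot[of s]]) (rule le_less_trans[OF monoD[OF mono]])
  qed
qed

section \<open>The system\<close>

lemma norm3_sq: "(norm (p :: real^3))\<^sup>2 = (p $ 1)\<^sup>2 + (p $ 2)\<^sup>2 + (p $ 3)\<^sup>2"
  by (simp add: norm_vec_def L2_set_def sum_3)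

lemma vf_nth [simp]:
  "vf b p $ 1 = p $ 1 + p $ 2 * p $ 3"
  "vf b p $ 2 = b * p $ 2 + p $ 1 * p $ 3"
  "vf b p $ 3 = p $ 3 - p $ 1 * p $ 2"
  by (simp_all add: vf_def Let_def)

lemma vf_eq_0_iff: "vf b p = 0 \<longleftrightarrow> p $ 1 = 0 \<and> p $ 3 = 0 \<and> b * p $ 2 = 0"
proof
  assume "vf b p = 0"
  then have eqs: "p $ 1 + p $ 2 * p $ 3 = 0" "b * p $ 2 + p $ 1 * p $ 3 = 0" "p $ 3 - p $ 1 * p $ 2 = 0"
    by (metis vf_nth zero_index)+
  \<comment> \<open>The first equation times x plus the third times z: the terms xyz cancel, the
    same cancellation that gives the radial law.\<close>
  have "(p $ 1)\<^sup>2 + (p $ 3)\<^sup>2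
      = p $ 1 * (p $ 1 + p $ 2 * p $ 3) + p $ 3 * (p $ 3 - p $ 1 * p $ 2)"
    by algebra
  also have "\<dots> = 0" using eqs by simp
  finally show "p $ 1 = 0 \<and> p $ 3 = 0 \<and> b * p $ 2 = 0"
    using eqs by (simp add: sum_power2_eq_zero_iff)
qed (simp add: vec_eq_iff forall_3)

lemma vf_locally_lipschitz: "\<exists>r>0. \<exists>L. L-lipschitz_on (cball p r) (vf b)"
proof -
  define R where "R = norm p + 1"
  \<comment> \<open>One constant for all three components: 1 for the linear terms in x and z,
    \<open>\<bar>b\<bar>\<close> for the linear term in y, and \<open>2 * R\<close> for a product of
    two coordinates bounded by \<open>R\<close>. The later factor 3 comes from summing
    components.\<close>
  define L where "L = 1 + \<bar>b\<bar> + 2 * R"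
  have R0: "R \<ge> 0" by (simp add: R_def)
  have coord: "\<bar>u $ i\<bar> \<le> R" if "u \<in> cball p 1" for u i
    using component_le_norm_cart[of u i] norm_triangle_sub[of u p] that
    by (simp add: R_def dist_norm norm_minus_commute)
  have prod: "\<bar>u $ i * u $ j - v $ i * v $ j\<bar> \<le> 2 * R * norm (u - v)"
    if "u \<in> cball p 1" "v \<in> cball p 1" for u v :: "real^3" and i j
  proof -
    have "u $ i * u $ j - v $ i * v $ j = u $ i * (u - v) $ j + v $ j * (u - v) $ i"
      by (simp add: algebra_simps)
    also have "\<bar>\<dots>\<bar> \<le> \<bar>u $ i\<bar> * \<bar>(u - v) $ j\<bar> + \<bar>v $ j\<bar> * \<bar>(u - v) $ i\<bar>"
      by (metis abs_mult abs_triangle_ineq)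
    also have "\<dots> \<le> R * norm (u - v) + R * norm (u - v)"
      by (intro add_mono mult_mono coord that component_le_norm_cart R0) auto
    finally show ?thesis by simp
  qed
  have lin: "\<bar>(u - v) $ i\<bar> \<le> norm (u - v)" for u v :: "real^3" and i
    by (rule component_le_norm_cart)
  have comp: "\<bar>(vf b u - vf b v) $ i\<bar> \<le> L * norm (u - v)"
    if "u \<in> cball p 1" "v \<in> cball p 1" for u v i
  proof -
    let ?D = "norm (u - v)"
    have b: "\<bar>b * (u - v) $ 2\<bar> \<le> \<bar>b\<bar> * ?D" "0 \<le> \<bar>b\<bar> * ?D" "0 \<le> ?D"
      using lin[of u v 2] by (auto simp: abs_mult intro: mult_left_mono)
    have y_comp: "(vf b u - vf b v) $ 2 = b * (u - v) $ 2 + (u $ 1 * u $ 3 - v $ 1 * v $ 3)"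
      by (simp add: right_diff_distrib)
    have L_D: "L * ?D = ?D + \<bar>b\<bar> * ?D + 2 * R * ?D"
      by (simp add: L_def distrib_right)
    consider "i = 1" | "i = 2" | "i = 3" using exhaust_3 by blast
    then show ?thesis
    proof cases
      case 1
      then show ?thesis
        using prod[OF that, of 2 3] lin[of u v 1] b by (simp add: L_def distrib_right)
    next
      case 2
      then show ?thesis
        unfolding 2 using prod[OF that, of 1 3] b y_comp L_D by linarith
    next
      case 3
      then show ?thesis
        using prod[OF that, of 1 2] lin[of u v 3] b by (simp add: L_def distrib_right)
    qed
  qed
  have "(3 * L)-lipschitz_on (cball p 1) (vf b)"
  proof (rule lipschitz_onI)
    fix u v assume "u \<in> cball p 1" "v \<in> cball p 1"
    note c = comp[OF this]
    have "norm (vf b u - vf b v) \<le> (\<Sum>i\<in>UNIV. \<bar>(vf b u - vf b v) $ i\<bar>)"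
      by (rule norm_le_l1_cart)
    also have "\<dots> \<le> (\<Sum>i\<in>(UNIV::3 set). L * norm (u - v))"
      by (intro sum_mono c)
    finally show "dist (vf b u) (vf b v) \<le> 3 * L * dist u v"
      by (simp add: dist_norm)
  qed (use R0 in \<open>simp add: L_def\<close>)
  then show ?thesis by (intro exI[of _ 1]) auto
qed

section \<open>A priori estimates along solutions of the system\<close>

context
  fixes b :: real and T :: "real set" and \<phi> :: "real \<Rightarrow> real^3"
  assumes sol: "solution_on (vf b) T \<phi>"
begin

lemma coord_deriv:
  assumes "t \<in> T"
  shows "((\<lambda>t. \<phi> t $ i) has_real_derivative vf b (\<phi> t) $ i) (at t)"
  using sol assms bounded_linear.has_vector_derivative[OF bounded_linear_vec_nth, of \<phi> "vf b (\<phi> t)" "at t" i]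
  by (simp add: solution_on_def has_real_derivative_iff_has_vector_derivative)

text \<open>The quotient of the squared radius by \<open>exp (2 * t)\<close> has derivative 0 on an
  interval. Being an exact equality for \<open>s\<close> and \<open>t\<close> in either order, the
  law serves both time directions.\<close>

lemma radius_growth:
  assumes "s \<in> T" "t \<in> T"
  shows "(\<phi> t $ 1)\<^sup>2 + (\<phi> t $ 3)\<^sup>2 = ((\<phi> s $ 1)\<^sup>2 + (\<phi> s $ 3)\<^sup>2) * exp (2 * (t - s))"
proof -
  let ?q = "\<lambda>t. ((\<phi> t $ 1)\<^sup>2 + (\<phi> t $ 3)\<^sup>2) * exp (- 2 * t)"
  have "(?q has_real_derivative 0) (at t)" if "t \<in> T" for t
    by (rule derivative_eq_intros coord_deriv that refl)+
       (simp, simp add: algebra_simps power2_eq_square)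
  then have "\<exists>c. \<forall>t\<in>T. ?q t = c"
    using sol by (intro has_field_derivative_zero_constant)
      (auto simp: solution_on_def is_interval_convex intro: has_field_derivative_at_within)
  then have "?q t * exp (2 * t) = ?q s * exp (2 * t)"
    using assms by metis
  then show ?thesis
    by (simp add: mult.assoc right_diff_distrib flip: exp_add)
qed

lemma solution_bounded: "bounded (\<phi> ` (T \<inter> {a..c}))"
proof (cases "T \<inter> {a..c} = {}")
  case False
  then obtain t0 where t0: "t0 \<in> T" "t0 \<in> {a..c}" by blast
  define C where "C = ((\<phi> t0 $ 1)\<^sup>2 + (\<phi> t0 $ 3)\<^sup>2) * exp (2 * (c - a))"
  define K where "K = 2 * \<bar>b\<bar> + 1"
  \<comment> \<open>Adding \<open>C\<^sup>2\<close> makes the estimate homogeneous: the forcing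
    contributes at most \<open>\<bar>y\<bar> * C \<le> y\<^sup>2 + C\<^sup>2\<close>, which
    \<open>K * W\<close> absorbs. Bounding the absolute value of \<open>W'\<close> allows Gronwall
    on both sides of \<open>t0\<close>.\<close>
  define W where "W t = (\<phi> t $ 2)\<^sup>2 + C\<^sup>2" for t
  define W' where "W' t = 2 * \<phi> t $ 2 * (b * \<phi> t $ 2 + \<phi> t $ 1 * \<phi> t $ 3)" for t
  have radius: "(\<phi> t $ 1)\<^sup>2 + (\<phi> t $ 3)\<^sup>2 \<le> C" if "t \<in> T \<inter> {a..c}" for t
    unfolding C_def using that t0
    by (subst radius_growth[of t0]) (auto intro!: mult_left_mono)
  have deriv: "(W has_real_derivative W' t) (at t)" if "t \<in> T" for t
    unfolding W_def W'_def
    by (rule derivative_eq_intros coord_deriv that refl)+ simp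
  have W'_le: "\<bar>W' t\<bar> \<le> K * W t" if "t \<in> T \<inter> {a..c}" for t
  proof -
    let ?x = "\<phi> t $ 1" and ?y = "\<phi> t $ 2" and ?z = "\<phi> t $ 3"
    have "\<bar>2 * (?x * ?z)\<bar> \<le> ?x\<^sup>2 + ?z\<^sup>2"
      using sum_squares_bound[of "\<bar>?x\<bar>" "\<bar>?z\<bar>"] by (simp add: abs_mult mult.assoc)
    then have xz: "\<bar>2 * (?x * ?z)\<bar> \<le> C" using radius[OF that] by simp
    have "W' t = (2 * b) * ?y\<^sup>2 + ?y * (2 * (?x * ?z))"
      by (simp add: W'_def algebra_simps power2_eq_square)
    also have "\<bar>\<dots>\<bar> \<le> (2 * \<bar>b\<bar>) * ?y\<^sup>2 + \<bar>?y\<bar> * \<bar>2 * (?x * ?z)\<bar>"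
      by (rule order_trans[OF abs_triangle_ineq]) (simp add: abs_mult)
    also have "\<dots> \<le> (2 * \<bar>b\<bar>) * ?y\<^sup>2 + \<bar>?y\<bar> * C"
      using xz by (intro add_left_mono mult_left_mono) auto
    also have "\<bar>?y\<bar> * C \<le> ?y\<^sup>2 + C\<^sup>2"
      using sum_squares_bound[of "\<bar>?y\<bar>" C] mult_nonneg_nonneg[of "\<bar>?y\<bar>" C] xz
      unfolding power2_abs by linarith
    also have "(2 * \<bar>b\<bar>) * ?y\<^sup>2 + (?y\<^sup>2 + C\<^sup>2) \<le> K * W t"
      by (simp add: K_def W_def algebra_simps)
    finally show ?thesis by simp
  qed
  have W_le: "W t \<le> W t0 * exp (K * (c - a))" if t: "t \<in> T \<inter> {a..c}" for t
  proof -
    have conn: "u \<in> T \<inter> {a..c}" if "u \<in> {min t t0..max t t0}" for u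
    proof
      have "min t t0 \<in> T" "max t t0 \<in> T"
        using t t0 by (auto simp: min_def max_def)
      then show "u \<in> T"
        using sol that unfolding solution_on_def is_interval_1 by (meson atLeastAtMost_iff)
      show "u \<in> {a..c}" using t t0 that by auto
    qed
    have "W t \<le> W t0 * exp (K * \<bar>t - t0\<bar>)"
    proof (cases "t0 \<le> t")
      case True
      then have "W t \<le> W t0 * exp (K * (t - t0))"
        using conn deriv W'_le by (intro exp_growth_bound[where W' = W']) (auto simp: abs_le_iff)
      with True show ?thesis by simp
    next
      case False
      have "W t \<le> W t0 * exp (- (- K) * (t0 - t))"
      proof (rule exp_decay_bound[where W' = W'])
        show "- K * W u \<le> W' u" if "u \<in> {t..t0}" for u
          using W'_le[of u] conn[of u] False that by (auto simp: abs_le_iff)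
      qed (use conn deriv False in auto)
      with False show ?thesis by simp
    qed
    also have "\<dots> \<le> W t0 * exp (K * (c - a))"
      using t t0 by (intro mult_left_mono) (auto simp: K_def W_def intro!: mult_left_mono)
    finally show ?thesis .
  qed
  have "norm (\<phi> t) \<le> sqrt (C + W t0 * exp (K * (c - a)))" if t: "t \<in> T \<inter> {a..c}" for t
  proof (rule real_le_rsqrt)
    show "(norm (\<phi> t))\<^sup>2 \<le> C + W t0 * exp (K * (c - a))"
      using radius[OF t] W_le[OF t] zero_le_power2[of C] unfolding norm3_sq W_def by linarith
  qed
  then show ?thesis unfolding bounded_iff by blast
qed simp

end

section \<open>Asymptotic behaviour of orbits\<close>

lemma vf_orbit_complete:
  assumes "orbit (vf b) T \<phi>"
  shows "T = UNIV"
proof (rule complete_orbit[OF vf_locally_lipschitz assms])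
  show "bounded (\<phi> ` (T \<inter> {a..c}))" for a c
    using assms by (intro solution_bounded[of b]) (auto simp: orbit_def)
qed

lemma radius_le_norm: "sqrt ((p $ 1)\<^sup>2 + (p $ 3)\<^sup>2) \<le> norm (p :: real^3)"
  by (rule real_le_lsqrt) (simp_all add: norm3_sq)

text \<open>One point off the axis gives a positive radius, whose exponential growth bounds the norm
  from below. This holds for every \<open>b\<close> and later also confines the stable manifold to
  the axis.\<close>

lemma vf_escapes_forward:
  assumes orb: "orbit (vf b) T \<phi>" and off: "\<not> \<phi> ` T \<subseteq> y_axis"
  shows "escapes_forward T \<phi>"
proof -
  have T: "T = UNIV" using vf_orbit_complete[OF orb] .
  have sol: "solution_on (vf b) UNIV \<phi>" using orb T by (simp add: orbit_def)
  obtain s where s: "\<phi> s \<notin> y_axis" using off by auto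
  define q where "q = (\<phi> s $ 1)\<^sup>2 + (\<phi> s $ 3)\<^sup>2"
  have q: "q > 0"
    using s by (auto simp: q_def y_axis_def sum_power2_gt_zero_iff)
  have "sqrt q * exp (t - s) \<le> norm (\<phi> t)" for t
  proof -
    have "sqrt q * exp (t - s) = sqrt (q * exp (2 * (t - s)))"
      unfolding exp_double real_sqrt_mult by simp
    also have "\<dots> \<le> norm (\<phi> t)"
      using radius_growth[OF sol, of s t] radius_le_norm[of "\<phi> t"] by (simp add: q_def)
    finally show ?thesis .
  qed
  then have "\<forall>\<^sub>F t in at_top. sqrt q * exp (t - s) \<le> norm (\<phi> t)"
    by simp
  moreover have "filterlim (\<lambda>t. sqrt q * exp (t - s)) at_top at_top"
    using q by real_asymp
  ultimately have "filterlim (\<lambda>t. norm (\<phi> t)) at_top at_top"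
    by (rule filterlim_at_top_mono[rotated])
  then show ?thesis by (simp add: escapes_forward_def T)
qed

lemma vf_repelling:
  assumes b: "b > 0"
  shows "globally_repelling (vf b) 0"
  unfolding globally_repelling_def
proof (intro allI impI)
  fix T \<phi> assume orb: "orbit (vf b) T \<phi>"
  have T: "T = UNIV" using vf_orbit_complete[OF orb] .
  have sol: "solution_on (vf b) UNIV \<phi>" using orb T by (simp add: orbit_def)
  define q where "q t = (\<phi> t $ 1)\<^sup>2 + (\<phi> t $ 3)\<^sup>2" for t
  \<comment> \<open>The constant \<open>k\<close> is chosen so that \<open>2xyz\<close> is absorbed: \<open>r\<^sup>2 \<le> r\<^sup>2(0)\<close> for \<open>t \<le> 0\<close>,
    hence \<open>\<bar>2xyz\<bar> \<le> \<bar>y\<bar> r\<^sup>2 \<le> b y\<^sup>2 + r\<^sup>2(0) r\<^sup>2 / (4b)\<close> by completing the square.\<close>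
  define k where "k = q 0 / (4 * b) + 1"
  \<comment> \<open>After absorption \<open>V'\<close> still exceeds
    \<open>b y\<^sup>2 + k r\<^sup>2\<close>, and \<open>c\<close> is the rate for which this
    dominates \<open>c * V\<close>.\<close>
  define c where "c = min b 1"
  define V where "V t = (\<phi> t $ 2)\<^sup>2 + k * q t" for t
  define V' where "V' t = 2 * b * (\<phi> t $ 2)\<^sup>2 + 2 * \<phi> t $ 1 * \<phi> t $ 2 * \<phi> t $ 3 + 2 * k * q t" for t
  have q0: "q t \<ge> 0" for t by (simp add: q_def)
  \<comment> \<open>The summand 1 in \<open>k\<close> ensures that \<open>V\<close> dominates the
    squared norm.\<close>
  have k1: "k \<ge> 1" using b q0[of 0] by (simp add: k_def)
  have deriv: "(V has_real_derivative V' t) (at t)" for t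
    unfolding V_def q_def
    by (rule derivative_eq_intros coord_deriv[OF sol] UNIV_I refl)+
       (simp add: V'_def q_def algebra_simps power2_eq_square)
  have V'_ge: "c * V t \<le> V' t" if "t \<le> 0" for t
  proof -
    let ?x = "\<phi> t $ 1" and ?y = "\<phi> t $ 2" and ?z = "\<phi> t $ 3"
    have "q t = q 0 * exp (2 * t)"
      using radius_growth[OF sol, of 0 t] by (simp add: q_def)
    then have q_le: "q t \<le> q 0"
      using that q0[of 0] by (simp add: mult_left_le)
    have xz: "\<bar>2 * (?x * ?z)\<bar> \<le> q t"
      using sum_squares_bound[of "\<bar>?x\<bar>" "\<bar>?z\<bar>"] by (simp add: abs_mult mult.assoc q_def)
    have "\<bar>2 * ?x * ?y * ?z\<bar> = \<bar>?y\<bar> * \<bar>2 * (?x * ?z)\<bar>"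
      by (simp add: abs_mult)
    also have "\<dots> \<le> \<bar>?y\<bar> * q t"
      by (intro mult_left_mono xz) simp
    also have "\<dots> \<le> b * ?y\<^sup>2 + q 0 / (4 * b) * q t"
    proof -
      have "0 \<le> (2 * b * \<bar>?y\<bar> - q t)\<^sup>2" by simp
      also have "\<dots> = 4 * b * (b * ?y\<^sup>2) + q t * q t - 4 * b * (\<bar>?y\<bar> * q t)"
        by (simp add: power2_diff power_mult_distrib) (simp add: power2_eq_square)
      also have "q t * q t \<le> q 0 * q t"
        by (intro mult_right_mono q_le q0)
      finally have "4 * b * (\<bar>?y\<bar> * q t) \<le> 4 * b * (b * ?y\<^sup>2 + q 0 / (4 * b) * q t)"
        using b by (simp add: distrib_left)
      then show ?thesis using b by (simp only: mult_le_cancel_left_pos)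
    qed
    also have "\<dots> \<le> b * ?y\<^sup>2 + k * q t"
      using q0[of t] by (simp add: k_def distrib_right)
    finally have "b * ?y\<^sup>2 + k * q t \<le> V' t"
      by (simp add: V'_def abs_le_iff)
    moreover have "c * V t \<le> b * ?y\<^sup>2 + k * q t"
    proof -
      have "c * ?y\<^sup>2 \<le> b * ?y\<^sup>2" "c * (k * q t) \<le> 1 * (k * q t)"
        using k1 q0[of t] by (intro mult_right_mono; simp add: c_def)+
      then show ?thesis by (simp add: V_def distrib_left)
    qed
    ultimately show ?thesis by simp
  qed
  have bound: "(norm (\<phi> t))\<^sup>2 \<le> V 0 * exp (c * t)" if "t \<le> 0" for t
  proof -
    have "(norm (\<phi> t))\<^sup>2 \<le> V t"
      using mult_right_mono[OF k1 q0[of t]] by (simp add: norm3_sq V_def q_def)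
    also have "\<dots> \<le> V 0 * exp (c * t)"
      using exp_decay_bound[OF that deriv V'_ge] by simp
    finally show ?thesis .
  qed
  have "((\<lambda>t. V 0 * exp (c * t)) \<longlongrightarrow> 0) at_bot"
    using b unfolding c_def by real_asymp
  moreover have "\<forall>\<^sub>F t in at_bot. (norm (\<phi> t))\<^sup>2 \<le> V 0 * exp (c * t)"
    by (rule eventually_mono[OF eventually_le_at_bot[of 0]]) (rule bound)
  ultimately have "((\<lambda>t. (norm (\<phi> t))\<^sup>2) \<longlongrightarrow> 0) at_bot"
    using tendsto_sandwich[of "\<lambda>_. 0" "\<lambda>t. (norm (\<phi> t))\<^sup>2" at_bot "\<lambda>t. V 0 * exp (c * t)" 0] by simp
  from tendsto_real_sqrt[OF this] have "((\<lambda>t. norm (\<phi> t)) \<longlongrightarrow> 0) at_bot"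
    by simp
  then show "tends_backward T \<phi> 0"
    by (simp add: tends_backward_def T tendsto_norm_zero_iff)
qed

lemma vf_0_tends_backward:
  assumes orb: "orbit (vf 0) T \<phi>"
  shows "\<exists>p\<in>y_axis. tends_backward T \<phi> p"
proof -
  have T: "T = UNIV" using vf_orbit_complete[OF orb] .
  have sol: "solution_on (vf 0) UNIV \<phi>" using orb T by (simp add: orbit_def)
  define Q where "Q = (\<phi> 0 $ 1)\<^sup>2 + (\<phi> 0 $ 3)\<^sup>2"
  have Q0: "Q \<ge> 0" by (simp add: Q_def)
  have q: "(\<phi> t $ 1)\<^sup>2 + (\<phi> t $ 3)\<^sup>2 = Q * exp (2 * t)" for t
    using radius_growth[OF sol, of 0 t] by (simp add: Q_def)
  have to_0: "((\<lambda>t. \<phi> t $ i) \<longlongrightarrow> 0) at_bot" if "i = 1 \<or> i = 3" for i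
  proof -
    have "((\<lambda>t. Q * exp (2 * t)) \<longlongrightarrow> 0) at_bot" by real_asymp
    moreover have "(\<phi> t $ i)\<^sup>2 \<le> Q * exp (2 * t)" for t
      using that q[of t, symmetric] by auto
    ultimately have "((\<lambda>t. (\<phi> t $ i)\<^sup>2) \<longlongrightarrow> 0) at_bot"
      using tendsto_sandwich[of "\<lambda>_. 0" "\<lambda>t. (\<phi> t $ i)\<^sup>2" at_bot "\<lambda>t. Q * exp (2 * t)" 0] by simp
    from tendsto_real_sqrt[OF this] show ?thesis
      by (simp add: tendsto_rabs_zero_iff)
  qed
  have xz: "\<bar>\<phi> t $ 1 * \<phi> t $ 3\<bar> \<le> Q * exp (2 * t) / 2" for t
    using sum_squares_bound[of "\<bar>\<phi> t $ 1\<bar>" "\<bar>\<phi> t $ 3\<bar>"] q[of t] by (simp add: abs_mult)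
  \<comment> \<open>The correction term makes \<open>u\<close> increasing and \<open>w\<close> decreasing, which forces \<open>y\<close> to converge.\<close>
  define u where "u t = \<phi> t $ 2 + Q / 4 * exp (2 * t)" for t
  define w where "w t = \<phi> t $ 2 - Q / 4 * exp (2 * t)" for t
  \<comment> \<open>The factor \<open>Q / 4\<close> is chosen so that the correction has derivative
    \<open>Q * exp (2 * t) / 2\<close>, exactly the bound on the absolute value of xz.\<close>
  have "(u has_real_derivative \<phi> t $ 1 * \<phi> t $ 3 + Q * exp (2 * t) / 2) (at t)" for t
    unfolding u_def by (rule derivative_eq_intros coord_deriv[OF sol] UNIV_I refl)+ simp
  moreover have "0 \<le> \<phi> t $ 1 * \<phi> t $ 3 + Q * exp (2 * t) / 2" for t
    using xz[of t] by linarith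
  ultimately have mono: "mono u"
    by (intro monoI) (metis DERIV_nonneg_imp_nondecreasing)
  have w': "(w has_real_derivative \<phi> t $ 1 * \<phi> t $ 3 - Q * exp (2 * t) / 2) (at t)" for t
    unfolding w_def by (rule derivative_eq_intros coord_deriv[OF sol] UNIV_I refl)+ simp
  have w'_le: "\<phi> t $ 1 * \<phi> t $ 3 - Q * exp (2 * t) / 2 \<le> 0" for t
    using xz[of t] by linarith
  \<comment> \<open>The decreasing \<open>w\<close> lies below \<open>u\<close>, so its value at 0
    bounds \<open>u\<close> from below in the past.\<close>
  have "w 0 \<le> u t" if "t \<le> 0" for t
  proof -
    have "w 0 \<le> w t"
      by (rule DERIV_nonpos_imp_nonincreasing[OF that]) (use w' w'_le in blast)
    also have "\<dots> \<le> u t" using Q0 by (simp add: w_def u_def)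
    finally show ?thesis .
  qed
  then obtain l where "(u \<longlongrightarrow> l) at_bot"
    using mono_bdd_below_tendsto_at_bot[OF mono] by blast
  moreover have "((\<lambda>t. Q / 4 * exp (2 * t)) \<longlongrightarrow> 0) at_bot" by real_asymp
  ultimately have "((\<lambda>t. u t - Q / 4 * exp (2 * t)) \<longlongrightarrow> l - 0) at_bot"
    by (rule tendsto_diff)
  then have y: "((\<lambda>t. \<phi> t $ 2) \<longlongrightarrow> l) at_bot" by (simp add: u_def)
  define p where "p = (vector [0, l, 0] :: real^3)"
  have "((\<lambda>t. \<phi> t $ i) \<longlongrightarrow> p $ i) at_bot" for i
    using exhaust_3[of i] to_0[of i] y by (auto simp: p_def)
  then have "(\<phi> \<longlongrightarrow> p) at_bot" by (rule vec_tendstoI)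
  moreover have "p \<in> y_axis" by (simp add: p_def y_axis_def)
  ultimately show ?thesis by (auto simp: tends_backward_def T)
qed

section \<open>Linearization and stable manifold at the origin\<close>

lemma vf_has_derivative_0: "(vf b has_derivative (\<lambda>h. vector [h $ 1, b * h $ 2, h $ 3])) (at 0)"
proof -
  have nth: "((\<lambda>p. p $ i) has_derivative (\<lambda>h. h $ i)) (at 0)" for i :: 3
    by (rule bounded_linear_imp_has_derivative[OF bounded_linear_vec_nth])
  have "((\<lambda>p. vf b p $ i) has_derivative (\<lambda>h. (vector [h $ 1, b * h $ 2, h $ 3] :: real^3) $ i)) (at 0)" for i
    using exhaust_3[of i]
    by (elim disjE) (simp_all, (auto intro!: derivative_eq_intros nth)+)
  then show ?thesis
    by (subst has_derivative_componentwise_within)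
      (auto simp: Basis_vec_def inner_axis)
qed

lemma vf_hyperbolic_0:
  assumes "b \<noteq> 0"
  shows "hyperbolic (vf b) 0"
  unfolding hyperbolic_def
proof (intro conjI allI impI)
  show "fixed_point (vf b) 0" by (simp add: fixed_point_def vf_eq_0_iff)
  show "vf b differentiable at 0"
    using vf_has_derivative_0 by (auto simp: differentiable_def)
  have fd: "frechet_derivative (vf b) (at 0) = (\<lambda>h. vector [h $ 1, b * h $ 2, h $ 3])"
    using frechet_derivative_at[OF vf_has_derivative_0] by simp
  fix \<mu> assume "eigenvalue (map_matrix complex_of_real (jacobian (vf b) (at 0))) \<mu>"
  then obtain v where v: "v \<noteq> 0" "map_matrix complex_of_real (jacobian (vf b) (at 0)) *v v = \<mu> *s v"
    by (auto simp: eigenvalue_def)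
  have "(map_matrix complex_of_real (jacobian (vf b) (at 0)) *v v) $ i = (\<mu> *s v) $ i" for i
    by (simp add: v)
  \<comment> \<open>The Jacobian is diagonal with entries 1, \<open>b\<close>, 1, so the eigenvalue
    equation decouples and any nonzero coordinate of \<open>v\<close> determines
    \<open>\<mu>\<close>.\<close>
  from this[of 1] this[of 2] this[of 3]
  have "v $ 1 = \<mu> * v $ 1" "b * v $ 2 = \<mu> * v $ 2" "v $ 3 = \<mu> * v $ 3"
    by (simp_all add: jacobian_def fd matrix_def matrix_vector_mult_def map_matrix_def sum_3 axis_def)
  moreover have "v $ 1 \<noteq> 0 \<or> v $ 2 \<noteq> 0 \<or> v $ 3 \<noteq> 0"
    using v(1) by (auto simp: vec_eq_iff forall_3)
  ultimately have "\<mu> = 1 \<or> \<mu> = b" by auto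
  then show "Re \<mu> \<noteq> 0" using assms by auto
qed

text \<open>Off the axis, escape to infinity contradicts convergence to the origin. On the axis all
  products vanish, and the explicit solution \<open>exp (b * t) *\<^sub>R q\<close>, living on the
  whole line, is automatically maximal.\<close>

lemma vf_stable_manifold:
  assumes b: "b < 0"
  shows "stable_manifold (vf b) 0 = y_axis"
proof
  show "stable_manifold (vf b) 0 \<subseteq> y_axis"
  proof
    fix q assume "q \<in> stable_manifold (vf b) 0"
    then obtain T \<phi> where orb: "orbit (vf b) T \<phi>" and 0: "0 \<in> T" "\<phi> 0 = q"
      and lim: "(\<phi> \<longlongrightarrow> 0) at_top"
      by (auto simp: stable_manifold_def tends_forward_def)
    have "\<not> escapes_forward T \<phi>"
      using lim not_tendsto_and_filterlim_at_infinity[of at_top \<phi> 0]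
      by (auto simp: escapes_forward_def filterlim_at_infinity_conv_norm_at_top)
    then show "q \<in> y_axis"
      using vf_escapes_forward[OF orb] 0 by blast
  qed
  show "y_axis \<subseteq> stable_manifold (vf b) 0"
  proof
    fix q assume q: "q \<in> y_axis"
    define \<phi> where "\<phi> t = exp (b * t) *\<^sub>R q" for t
    have "vf b (\<phi> t) = (b * exp (b * t)) *\<^sub>R q" for t
      using q by (simp add: vec_eq_iff forall_3 \<phi>_def y_axis_def)
    moreover have "(\<phi> has_vector_derivative (b * exp (b * t)) *\<^sub>R q) (at t)" for t
      unfolding \<phi>_def by (auto intro!: derivative_eq_intros)
    ultimately have "orbit (vf b) UNIV \<phi>"
      by (auto simp: orbit_def solution_on_def)
    moreover have "(\<phi> \<longlongrightarrow> 0) at_top"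
    proof -
      have "((\<lambda>t. exp (b * t)) \<longlongrightarrow> 0) at_top" using b by real_asymp
      from tendsto_scaleR[OF this tendsto_const[of q]] show ?thesis by (simp add: \<phi>_def[abs_def])
    qed
    moreover have "\<phi> 0 = q" by (simp add: \<phi>_def)
    ultimately show "q \<in> stable_manifold (vf b) 0"
      unfolding stable_manifold_def tends_forward_def by fastforce
  qed
qed

text \<open>The stable manifold is a linear subspace, so its being one-dimensional can be expressed
  by \<open>dim\<close>; the spanning vector supplies this value.\<close>

lemma y_axis_eq_span: "y_axis = span {axis 2 1}"
proof -
  have "p \<in> y_axis \<longleftrightarrow> (\<exists>k. p = k *\<^sub>R axis 2 1)" for p
    by (auto simp: y_axis_def vec_eq_iff forall_3 axis_def)
  then show ?thesis by (auto simp: span_singleton)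
qed

theorem mainTheorem3:
  fixes b :: real
  shows "(b > 0 \<longrightarrow>
            (\<exists>!p. fixed_point (vf b) p) \<and> fixed_point (vf b) 0 \<and> globally_repelling (vf b) 0)
       \<and> (b = 0 \<longrightarrow>
            (\<forall>p\<in>y_axis. fixed_point (vf b) p) \<and>
            (\<forall>T \<phi>. orbit (vf b) T \<phi> \<and> \<not> \<phi> ` T \<subseteq> y_axis \<longrightarrow>
               (\<exists>p\<in>y_axis. tends_backward T \<phi> p) \<and> escapes_forward T \<phi>))
       \<and> (b < 0 \<longrightarrow>
            (\<exists>!p. fixed_point (vf b) p) \<and> fixed_point (vf b) 0 \<and> hyperbolic (vf b) 0 \<and>
            stable_manifold (vf b) 0 = y_axis \<and>
            subspace (stable_manifold (vf b) 0) \<and> dim (stable_manifold (vf b) 0) = 1 \<and>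
            (\<forall>T \<phi>. orbit (vf b) T \<phi> \<and> \<not> \<phi> ` T \<subseteq> y_axis \<longrightarrow> escapes_forward T \<phi>))"
proof -
  have origin: "fixed_point (vf b) 0"
    by (simp add: fixed_point_def vf_eq_0_iff)
  have unique: "\<exists>!p. fixed_point (vf b) p" if "b \<noteq> 0"
  proof (rule ex1I[of _ 0])
    show "p = 0" if "fixed_point (vf b) p" for p
      using that \<open>b \<noteq> 0\<close> unfolding fixed_point_def vf_eq_0_iff by (simp add: vec_eq_iff forall_3)
  qed (rule origin)
  have "axis 2 1 \<noteq> (0 :: real^3)" by (simp add: axis_eq_0_iff)
  then have dim: "dim y_axis = 1" and subsp: "subspace y_axis"
    by (simp_all add: y_axis_eq_span dim_insert subspace_span)
  have escape: "\<forall>T \<phi>. orbit (vf b) T \<phi> \<and> \<not> \<phi> ` T \<subseteq> y_axis \<longrightarrow> escapes_forward T \<phi>"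
    using vf_escapes_forward by blast
  have "\<forall>p\<in>y_axis. fixed_point (vf b) p" if "b = 0"
    using that unfolding fixed_point_def vf_eq_0_iff y_axis_def by simp
  then have "b = 0 \<longrightarrow> (\<forall>p\<in>y_axis. fixed_point (vf b) p) \<and>
      (\<forall>T \<phi>. orbit (vf b) T \<phi> \<and> \<not> \<phi> ` T \<subseteq> y_axis \<longrightarrow>
         (\<exists>p\<in>y_axis. tends_backward T \<phi> p) \<and> escapes_forward T \<phi>)"
    using vf_0_tends_backward escape by blast
  moreover have "b > 0 \<longrightarrow> (\<exists>!p. fixed_point (vf b) p) \<and> globally_repelling (vf b) 0"
    using unique vf_repelling by simp
  moreover have "b < 0 \<longrightarrow> (\<exists>!p. fixed_point (vf b) p) \<and> hyperbolic (vf b) 0 \<and>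
      stable_manifold (vf b) 0 = y_axis"
    using unique vf_hyperbolic_0 vf_stable_manifold by simp
  ultimately show ?thesis
    using origin escape dim subsp by (intro conjI impI) simp_all
qed

end
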